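(* Let $\omega\in\mathbb{R}^\ell$, let $A:\mathbb{T}^\ell\to\mathbb{R}^{p\times p}$, $B:\mathbb{T}^\ell\to GL(q,\mathbb{R})$ and $\eta:\mathbb{T}^\ell\to\mathbb{R}^{p\times q}$ be continuous, and suppose there is a constant $\kappa<1$ with $\|A(\theta)\|\cdot\|B^{-1}(\theta)\|\le\kappa$ for all $\theta\in\mathbb{T}^\ell$. Define recursively, for $n\ge0$, $$D_{n+1}(\theta)=A_n(\theta)\,D_n(\theta-2^n\omega)\,B_n^{-1}(\theta)+D_n(\theta),$$ $$A_{n+1}(\theta)=A_n(\theta)A_n(\theta-2^n\omega),\qquad B_{n+1}^{-1}(\theta)=B_n^{-1}(\theta-2^n\omega)B_n^{-1}(\theta),$$ with $A_0=A$, $B_0^{-1}=B^{-1}$, $D_0=-\eta B^{-1}$. Then $(D_n)$ converges uniformly on $\mathbb{T}^\ell$ to a continuous function $D$; the convergence is superexponential in $n$, i.e. for every $c>0$, $e^{cn}\sup_{\theta\in\mathbb{T}^\ell}\|D(\theta)-D_n(\theta)\|\to0$ as $n\to\infty$; and the function $\Delta(\theta)=D(\theta-\omega)$ solves $$A(\theta)\Delta(\theta)-\Delta(\theta+\omega)B(\theta)=\eta(\theta)\qquad\text{for all }\theta\in\mathbb{T}^\ell.$$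
   Context: $\mathbb{T}^\ell=\mathbb{R}^\ell/\mathbb{Z}^\ell$, and $\theta\pm\omega$ is understood modulo $\mathbb{Z}^\ell$. $\|\cdot\|$ denotes the Euclidean operator norm of a matrix. The symbol $B_n^{-1}$ denotes the matrix function produced by the recursion. *)

theory Defs
  imports "HOL-Analysis.Analysis"
begin

definition int_lattice_rel :: "real ^ 'l \<Rightarrow> real ^ 'l \<Rightarrow> bool"
  where "int_lattice_rel x y \<longleftrightarrow> (\<forall>i. x $ i - y $ i \<in> \<int>)"

lemma int_lattice_rel_equivp: "equivp int_lattice_rel"
proof (rule equivpI)
  show "reflp int_lattice_rel"
    by (simp add: reflp_def int_lattice_rel_def)
  show "symp int_lattice_rel"
    unfolding symp_def int_lattice_rel_def by (metis Ints_minus minus_diff_eq)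
  show "transp int_lattice_rel"
  proof (rule transpI)
    fix x y z :: "real ^ 'l"
    assume xy: "int_lattice_rel x y" and yz: "int_lattice_rel y z"
    have "x $ i - z $ i \<in> \<int>" for i
    proof -
      have "(x $ i - y $ i) + (y $ i - z $ i) \<in> \<int>"
        using xy yz unfolding int_lattice_rel_def by (intro Ints_add) auto
      then show ?thesis by simp
    qed
    then show "int_lattice_rel x z" by (simp add: int_lattice_rel_def)
  qed
qed

quotient_type (overloaded) 'l torus = "real ^ 'l::finite" / int_lattice_rel
  morphisms rep_torus torus_of
  by (rule int_lattice_rel_equivp)

instantiation torus :: (finite) ab_group_add
begin

lift_definition zero_torus :: "'a torus" is 0 .

lift_definition plus_torus :: "'a torus \<Rightarrow> 'a torus \<Rightarrow> 'a torus" is "(+)"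
  unfolding int_lattice_rel_def vector_add_component
  by (metis (no_types, lifting) Ints_add add_diff_add)

lift_definition uminus_torus :: "'a torus \<Rightarrow> 'a torus" is uminus
  unfolding int_lattice_rel_def vector_uminus_component
  by (metis Ints_minus minus_diff_minus)

lift_definition minus_torus :: "'a torus \<Rightarrow> 'a torus \<Rightarrow> 'a torus" is "(-)"
  unfolding int_lattice_rel_def vector_minus_component
  by (metis (no_types, lifting) Ints_diff diff_diff_eq2 add_diff_eq diff_add_eq diff_diff_eq
      add.commute)

instance
  by standard (transfer; simp add: int_lattice_rel_def algebra_simps)+

end

instantiation torus :: (finite) topological_space
begin

definition open_torus :: "'a torus set \<Rightarrow> bool"
  where "open_torus U \<longleftrightarrow> open (torus_of -` U)"

instance
  by standard (auto simp: open_torus_def vimage_Union)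

end

definition op_norm :: "real ^ 'n ^ 'm \<Rightarrow> real"
  where "op_norm M = onorm ((*v) M)"

primrec A_seq ::
  "real ^ 'l \<Rightarrow> ('l torus \<Rightarrow> real ^ 'p ^ 'p) \<Rightarrow> nat \<Rightarrow> 'l torus \<Rightarrow> real ^ 'p ^ 'p"
where
  "A_seq \<omega> A 0 = A"
| "A_seq \<omega> A (Suc n) =
    (\<lambda>\<theta>. A_seq \<omega> A n \<theta> ** A_seq \<omega> A n (\<theta> - torus_of (2 ^ n *\<^sub>R \<omega>)))"

primrec Binv_seq ::
  "real ^ 'l \<Rightarrow> ('l torus \<Rightarrow> real ^ 'q ^ 'q) \<Rightarrow> nat \<Rightarrow> 'l torus \<Rightarrow> real ^ 'q ^ 'q"
where
  "Binv_seq \<omega> B 0 = (\<lambda>\<theta>. matrix_inv (B \<theta>))"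
| "Binv_seq \<omega> B (Suc n) =
    (\<lambda>\<theta>. Binv_seq \<omega> B n (\<theta> - torus_of (2 ^ n *\<^sub>R \<omega>)) ** Binv_seq \<omega> B n \<theta>)"

primrec D_seq ::
  "real ^ 'l \<Rightarrow> ('l torus \<Rightarrow> real ^ 'p ^ 'p) \<Rightarrow> ('l torus \<Rightarrow> real ^ 'q ^ 'q) \<Rightarrow>
    ('l torus \<Rightarrow> real ^ 'q ^ 'p) \<Rightarrow> nat \<Rightarrow> 'l torus \<Rightarrow> real ^ 'q ^ 'p"
where
  "D_seq \<omega> A B \<eta> 0 = (\<lambda>\<theta>. - (\<eta> \<theta> ** matrix_inv (B \<theta>)))"
| "D_seq \<omega> A B \<eta> (Suc n) =
    (\<lambda>\<theta>. A_seq \<omega> A n \<theta> ** D_seq \<omega> A B \<eta> n (\<theta> - torus_of (2 ^ n *\<^sub>R \<omega>))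
            ** Binv_seq \<omega> B n \<theta> + D_seq \<omega> A B \<eta> n \<theta>)"

end

theory Submission
  imports Defs "HOL-Real_Asymp.Real_Asymp"
begin

text \<open>
  Put \<open>Q = B\<^sup>-\<^sup>1\<close> and let \<open>L\<close> be the weighted shift \<open>(L f) \<theta> = A \<theta> f(\<theta> - \<omega>) Q \<theta>\<close>.
  Multiplied by \<open>Q\<close> on the right and with \<open>\<Delta> \<theta> = D (\<theta> - \<omega>)\<close>, the cohomological equation
  becomes the fixed point equation \<open>D = D\<^sub>0 + L D\<close> with \<open>D\<^sub>0 = -\<eta> Q\<close>. The bound
  \<open>\<parallel>A\<parallel> \<parallel>Q\<parallel> \<le> \<kappa> < 1\<close> makes \<open>L\<close> a contraction for the supremum norm
  (\<open>op_norm_weighted_shift_pow_le\<close>), so the solution is the Neumann series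
  \<open>D = \<Sum>\<^sub>k L\<^sup>k D\<^sub>0\<close>, which converges uniformly because \<open>D\<^sub>0\<close> is bounded on the compact
  torus.

  The recursion is the repeated squaring scheme for this series. The pair \<open>(A\<^sub>n, B\<^sub>n\<^sup>-\<^sup>1)\<close>
  consists of the weights of \<open>L\<close> iterated \<open>2\<^sup>n\<close> times (\<open>weighted_shift_pow_two_power\<close>),
  so a step adds to \<open>D\<^sub>n\<close> its image under that iterate and doubles the number of terms:
  \<open>D\<^sub>n\<close> is the partial sum over \<open>k < 2\<^sup>n\<close> (\<open>D_seq_eq_partial_sum\<close>). Iterating the fixed point
  equation shows that the error after \<open>N\<close> terms is exactly \<open>L\<^sup>N D\<close>. With \<open>N = 2\<^sup>n\<close> its norm is
  at most \<open>\<kappa>\<close> to the power \<open>2\<^sup>n\<close>, times \<open>sup \<parallel>D\<parallel>\<close>, which beats every exponential.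
\<close>

section \<open>Matrix preliminaries\<close>

lemma bounded_bilinear_matrix_mult:
  "bounded_bilinear ((**) :: real^'n^'m \<Rightarrow> real^'k^'n \<Rightarrow> real^'k^'m)"
  unfolding bilinear_conv_bounded_bilinear [symmetric] bilinear_def linear_iff
  by (auto simp: matrix_matrix_mult_def vec_eq_iff algebra_simps sum.distrib sum_distrib_left)

lemmas continuous_on_matrix_mult =
  bounded_bilinear.continuous_on [OF bounded_bilinear_matrix_mult]

lemma matrix_mult_inv:
  assumes "invertible M"
  shows "M ** matrix_inv M = mat 1" "matrix_inv M ** M = mat 1"
  using someI_ex [OF assms [unfolded invertible_def]] by (auto simp: matrix_inv_def)

text \<open>
  Continuity of the inverse is read off from Cramer's rule: each entry is a quotient of
  determinants, hence of polynomials in the entries of the matrix.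
\<close>

lemma matrix_inv_cramer:
  fixes M :: "real^'n^'n"
  assumes "invertible M"
  shows "matrix_inv M $ i $ j =
    det (\<chi> a b. if b = i then axis j 1 $ a else M $ a $ b) / det M"
proof -
  have "M *v (matrix_inv M *v axis j 1) = axis j 1"
    by (simp add: matrix_vector_mul_assoc matrix_mult_inv [OF assms])
  moreover have "det M \<noteq> 0"
    using assms by (simp add: invertible_det_nz)
  ultimately have "matrix_inv M *v axis j 1 =
      (\<chi> k. det (\<chi> a b. if b = k then axis j 1 $ a else M $ a $ b) / det M)"
    using cramer by blast
  moreover have "(matrix_inv M *v axis j 1) $ i = matrix_inv M $ i $ j"
    by (simp add: matrix_vector_mult_basis column_def)
  ultimately show ?thesis by simp
qed

lemma continuous_on_det:
  fixes M :: "'x::topological_space \<Rightarrow> real^'n^'n"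
  assumes "\<And>i j. continuous_on S (\<lambda>x. M x $ i $ j)"
  shows "continuous_on S (\<lambda>x. det (M x))"
  unfolding det_def by (intro continuous_intros assms)

lemma continuous_on_matrix_inv:
  fixes M :: "'x::topological_space \<Rightarrow> real^'n^'n"
  assumes M: "continuous_on S M" and inv: "\<And>x. x \<in> S \<Longrightarrow> invertible (M x)"
  shows "continuous_on S (\<lambda>x. matrix_inv (M x))"
proof -
  have entry: "continuous_on S (\<lambda>x. M x $ a $ b)" for a b
    by (intro continuous_intros M)
  have inv_entry: "continuous_on S (\<lambda>x. matrix_inv (M x) $ i $ j)" for i j
  proof -
    have "continuous_on S (\<lambda>x. (\<chi> a b. if b = i then axis j 1 $ a else M x $ a $ b) $ a' $ b')"
      for a' b' by (cases "b' = i") (simp_all add: entry)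
    then have "continuous_on S
        (\<lambda>x. det (\<chi> a b. if b = i then axis j 1 $ a else M x $ a $ b) / det (M x))"
      using inv by (intro continuous_on_divide continuous_on_det entry)
        (auto simp: invertible_det_nz)
    then show ?thesis
      by (rule continuous_on_eq) (simp add: matrix_inv_cramer inv)
  qed
  have "continuous_on S (\<lambda>x. \<chi> i j. matrix_inv (M x) $ i $ j)"
    by (intro continuous_on_vec_lambda inv_entry)
  then show ?thesis by simp
qed

lemma op_norm_nonneg: "0 \<le> op_norm M"
  unfolding op_norm_def by (rule onorm_pos_le) simp

lemma op_norm_mult_le: "op_norm (M ** N) \<le> op_norm M * op_norm N"
proof -
  have "(*v) (M ** N) = (*v) M \<circ> (*v) N"
    by (simp add: fun_eq_iff matrix_vector_mul_assoc)
  then show ?thesis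
    unfolding op_norm_def by (simp add: onorm_compose)
qed

text \<open>
  Convergence and continuity of matrix functions refer to the Euclidean norm of the entries,
  the contraction estimate to the operator norm. These two bounds translate between them.
\<close>

lemma op_norm_le_norm:
  fixes M :: "real^'n^'m"
  shows "op_norm M \<le> real CARD('m) * real CARD('n) * norm M"
  unfolding op_norm_def
proof (rule onorm_le_matrix_component)
  fix i j
  show "\<bar>M $ i $ j\<bar> \<le> norm M"
    using component_le_norm_cart [of "M $ i" j] Finite_Cartesian_Product.norm_nth_le [of M i]
    by linarith
qed

lemma norm_le_op_norm:
  fixes M :: "real^'n^'m"
  shows "norm M \<le> real CARD('m) * real CARD('n) * op_norm M"
proof -
  have "norm M \<le> (\<Sum>i\<in>UNIV. norm (M $ i))"
    unfolding norm_vec_def by (rule L2_set_le_sum) simp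
  also have "\<dots> \<le> (\<Sum>i\<in>UNIV. \<Sum>j\<in>UNIV. \<bar>M $ i $ j\<bar>)"
    by (intro sum_mono norm_le_l1_cart)
  also have "\<dots> \<le> (\<Sum>i\<in>(UNIV::'m set). \<Sum>j\<in>(UNIV::'n set). op_norm M)"
    unfolding op_norm_def by (intro sum_mono matrix_component_le_onorm)
  finally show ?thesis by simp
qed

section \<open>The torus\<close>

lemma torus_of_add: "torus_of (x + y) = torus_of x + torus_of y"
  by (simp add: plus_torus.abs_eq)

lemma continuous_on_torus_of: "continuous_on UNIV torus_of"
  unfolding continuous_on_open_vimage [OF open_UNIV] by (auto simp: open_torus_def)

text \<open>
  Reducing coordinates to their fractional parts shows that the unit cube maps onto the torus.
\<close>

lemma compact_torus: "compact (UNIV :: 'l::finite torus set)"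
proof -
  have "\<theta> \<in> torus_of ` cbox 0 1" for \<theta> :: "'l torus"
  proof -
    define x where "x = rep_torus \<theta>"
    define y :: "real^'l" where "y = (\<chi> i. frac (x $ i))"
    have "torus_of y = torus_of x"
      by (auto simp: torus.abs_eq_iff int_lattice_rel_def y_def frac_def)
    then have "torus_of y = \<theta>"
      using Quotient_abs_rep [OF Quotient_torus] by (simp add: x_def)
    moreover have "y \<in> cbox 0 1"
      by (auto simp: mem_box_cart y_def frac_lt_1 less_imp_le)
    ultimately show ?thesis by blast
  qed
  then have "torus_of ` cbox 0 1 = (UNIV :: 'l torus set)"
    by blast
  then show ?thesis
    using compact_continuous_image [OF continuous_on_subset [OF continuous_on_torus_of]]
    by (metis compact_cbox subset_UNIV)
qed

lemma continuous_on_torus_translation: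
  "continuous_on UNIV (\<lambda>\<theta> :: 'l::finite torus. \<theta> - \<alpha>)"
proof -
  obtain a where \<alpha>: "\<alpha> = torus_of a"
    using Quotient_abs_rep [OF Quotient_torus] by metis
  have "open ((\<lambda>\<theta>. \<theta> - \<alpha>) -` U)" if "open U" for U :: "'l torus set"
  proof -
    have "torus_of -` ((\<lambda>\<theta>. \<theta> - \<alpha>) -` U) = (\<lambda>x. x - a) -` (torus_of -` U)"
      by (auto simp: \<alpha> minus_torus.abs_eq)
    moreover have "open ((\<lambda>x. x - a) -` (torus_of -` U))"
    proof (rule open_vimage)
      show "open (torus_of -` U)"
        using that by (simp only: open_torus_def)
    qed (intro continuous_intros)
    ultimately show ?thesis by (simp add: open_torus_def)
  qed
  then show ?thesis
    unfolding continuous_on_open_vimage [OF open_UNIV] by simp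
qed

lemma op_norm_bounded_on_torus:
  fixes f :: "'l::finite torus \<Rightarrow> real^'n^'m"
  assumes "continuous_on UNIV f"
  obtains M where "\<And>\<theta>. op_norm (f \<theta>) \<le> M"
proof -
  obtain K where K: "\<And>\<theta>. norm (f \<theta>) \<le> K"
    using compact_imp_bounded [OF compact_continuous_image [OF assms compact_torus]]
    unfolding bounded_iff by blast
  have "op_norm (f \<theta>) \<le> real CARD('m) * real CARD('n) * K" for \<theta>
    using op_norm_le_norm [of "f \<theta>"] K [of \<theta>]
    by (meson mult_left_mono mult_nonneg_nonneg of_nat_0_le_iff order_trans)
  then show thesis by (rule that)
qed

section \<open>The weighted shift\<close>

text \<open>
  The transfer operator of the cocycle \<open>(P, Q)\<close> over the translation by \<open>\<alpha>\<close>.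
\<close>

definition weighted_shift ::
  "'x::ab_group_add \<Rightarrow> ('x \<Rightarrow> real^'p^'p) \<Rightarrow> ('x \<Rightarrow> real^'q^'q) \<Rightarrow>
    ('x \<Rightarrow> real^'q^'p) \<Rightarrow> 'x \<Rightarrow> real^'q^'p"
where
  "weighted_shift \<alpha> P Q f = (\<lambda>\<theta>. P \<theta> ** f (\<theta> - \<alpha>) ** Q \<theta>)"

lemma bounded_linear_sandwich:
  "bounded_linear (\<lambda>X :: real^'n^'m. (P :: real^'m^'k) ** X ** (Q :: real^'l^'n))"
  using bounded_linear_compose
    [OF bounded_bilinear.bounded_linear_left [OF bounded_bilinear_matrix_mult]
        bounded_bilinear.bounded_linear_right [OF bounded_bilinear_matrix_mult]] .

lemma weighted_shift_pow_Suc: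
  "(weighted_shift \<alpha> P Q ^^ Suc k) f =
    (\<lambda>\<theta>. P \<theta> ** (weighted_shift \<alpha> P Q ^^ k) f (\<theta> - \<alpha>) ** Q \<theta>)"
  by (simp add: weighted_shift_def)

lemma weighted_shift_pow_add:
  "(weighted_shift \<alpha> P Q ^^ m) (\<lambda>\<theta>. f \<theta> + g \<theta>) =
    (\<lambda>\<theta>. (weighted_shift \<alpha> P Q ^^ m) f \<theta> + (weighted_shift \<alpha> P Q ^^ m) g \<theta>)"
proof (induction m)
  case (Suc m)
  then show ?case
    by (simp add: weighted_shift_def fun_eq_iff
        linear_add [OF bounded_linear.linear [OF bounded_linear_sandwich]])
qed simp

lemma weighted_shift_pow_sum:
  "(weighted_shift \<alpha> P Q ^^ m) (\<lambda>\<theta>. \<Sum>k\<in>K. f k \<theta>) =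
    (\<lambda>\<theta>. \<Sum>k\<in>K. (weighted_shift \<alpha> P Q ^^ m) (f k) \<theta>)"
proof (induction m)
  case (Suc m)
  then show ?case
    by (simp add: weighted_shift_def fun_eq_iff
        linear_sum [OF bounded_linear.linear [OF bounded_linear_sandwich]])
qed simp

text \<open>
  Only the product \<open>\<parallel>P \<theta>\<parallel> \<parallel>Q \<theta>\<parallel>\<close> at a common point enters, because both
  weights of a single shift are evaluated at the same \<open>\<theta>\<close>. Bounding the iterated weights
  separately would lose this pairing.
\<close>

lemma op_norm_weighted_shift_pow_le:
  assumes PQ: "\<And>\<theta>. op_norm (P \<theta>) * op_norm (Q \<theta>) \<le> \<kappa>"
    and f: "\<And>\<theta>. op_norm (f \<theta>) \<le> M"
  shows "op_norm ((weighted_shift \<alpha> P Q ^^ k) f \<theta>) \<le> \<kappa> ^ k * M"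
proof (induction k arbitrary: \<theta>)
  case 0
  then show ?case by (simp add: f)
next
  case (Suc k)
  let ?g = "(weighted_shift \<alpha> P Q ^^ k) f"
  have "op_norm (P \<theta> ** ?g (\<theta> - \<alpha>) ** Q \<theta>)
      \<le> op_norm (P \<theta>) * op_norm (?g (\<theta> - \<alpha>)) * op_norm (Q \<theta>)"
    by (meson op_norm_mult_le op_norm_nonneg mult_right_mono order_trans)
  also have "\<dots> = op_norm (P \<theta>) * op_norm (Q \<theta>) * op_norm (?g (\<theta> - \<alpha>))"
    by simp
  also have "\<dots> \<le> \<kappa> * op_norm (?g (\<theta> - \<alpha>))"
    by (intro mult_right_mono PQ op_norm_nonneg)
  also have "\<dots> \<le> \<kappa> * (\<kappa> ^ k * M)"
    using order_trans [OF mult_nonneg_nonneg [OF op_norm_nonneg op_norm_nonneg] PQ]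
    by (intro mult_left_mono Suc.IH)
  finally show ?case
    by (simp only: weighted_shift_pow_Suc power_Suc mult.assoc)
qed

lemma continuous_on_weighted_shift_pow:
  fixes P :: "'l::finite torus \<Rightarrow> real^'p^'p"
  assumes "continuous_on UNIV P" "continuous_on UNIV Q" "continuous_on UNIV f"
  shows "continuous_on UNIV ((weighted_shift \<alpha> P Q ^^ k) f)"
proof (induction k)
  case 0
  then show ?case by (simp add: assms)
next
  case (Suc k)
  have "continuous_on UNIV (\<lambda>\<theta>. (weighted_shift \<alpha> P Q ^^ k) f (\<theta> - \<alpha>))"
    by (rule continuous_on_compose2 [OF Suc continuous_on_torus_translation]) simp
  then have "continuous_on UNIV
      (\<lambda>\<theta>. P \<theta> ** (weighted_shift \<alpha> P Q ^^ k) f (\<theta> - \<alpha>) ** Q \<theta>)"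
    by (intro continuous_on_matrix_mult assms)
  then show ?case
    by (simp only: weighted_shift_pow_Suc)
qed

section \<open>Repeated squaring of the Neumann series\<close>

text \<open>
  Composing the iterate of order \<open>2\<^sup>n\<close> with itself translates by \<open>2\<^sup>n \<omega>\<close> twice and multiplies
  the weights in exactly the order prescribed by the recursions for \<open>A_seq\<close> and \<open>Binv_seq\<close>.
\<close>

lemma weighted_shift_pow_two_power:
  "(weighted_shift (torus_of \<omega>) A (\<lambda>\<theta>. matrix_inv (B \<theta>)) ^^ 2 ^ n) f \<theta> =
    A_seq \<omega> A n \<theta> ** f (\<theta> - torus_of (2 ^ n *\<^sub>R \<omega>)) ** Binv_seq \<omega> B n \<theta>"
proof (induction n arbitrary: f \<theta>)
  case 0
  then show ?case by (simp add: weighted_shift_def)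
next
  case (Suc n)
  have "2 ^ Suc n *\<^sub>R \<omega> = 2 ^ n *\<^sub>R \<omega> + 2 ^ n *\<^sub>R \<omega>"
    by (simp flip: scaleR_add_left)
  then have shift_twice: "\<theta> - torus_of (2 ^ n *\<^sub>R \<omega>) - torus_of (2 ^ n *\<^sub>R \<omega>) = 
      \<theta> - torus_of (2 ^ Suc n *\<^sub>R \<omega>)"
    by (simp only: torus_of_add diff_diff_add)
  have pow_twice: "(weighted_shift (torus_of \<omega>) A (\<lambda>\<theta>. matrix_inv (B \<theta>)) ^^ 2 ^ Suc n) f \<theta> =
    (weighted_shift (torus_of \<omega>) A (\<lambda>\<theta>. matrix_inv (B \<theta>)) ^^ 2 ^ n)
      ((weighted_shift (torus_of \<omega>) A (\<lambda>\<theta>. matrix_inv (B \<theta>)) ^^ 2 ^ n) f) \<theta>"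
    by (simp add: mult_2 funpow_add)
  show ?case
    by (simp only: pow_twice Suc.IH shift_twice A_seq.simps Binv_seq.simps matrix_mul_assoc)
qed

text \<open>
  Applying the iterate of order \<open>2\<^sup>n\<close> to the first \<open>2\<^sup>n\<close> terms of the Neumann series
  produces the next \<open>2\<^sup>n\<close> terms.
\<close>

lemma D_seq_eq_partial_sum:
  fixes \<eta> :: "'l::finite torus \<Rightarrow> real^'c^'b"
  shows "D_seq \<omega> A B \<eta> n \<theta> =
    (\<Sum>k<2 ^ n. (weighted_shift (torus_of \<omega>) A (\<lambda>\<theta>. matrix_inv (B \<theta>)) ^^ k)
        (D_seq \<omega> A B \<eta> 0) \<theta>)"
proof (induction n arbitrary: \<theta>)
  case 0
  then show ?case by simp
next
  case (Suc n)
  let ?L = "weighted_shift (torus_of \<omega>) A (\<lambda>\<theta>. matrix_inv (B \<theta>))"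
    and ?D0 = "D_seq \<omega> A B \<eta> 0"
  have sum_split: "(\<Sum>k<m + j. f k) = (\<Sum>k<m. f k) + (\<Sum>k<j. f (m + k))"
    for m j :: nat and f :: "nat \<Rightarrow> real^'c^'b"
    by (induction j) (simp_all add: add.assoc)
  have "D_seq \<omega> A B \<eta> n = (\<lambda>\<theta>. \<Sum>k<2 ^ n. (?L ^^ k) ?D0 \<theta>)"
    using Suc.IH by blast
  then have "(?L ^^ 2 ^ n) (D_seq \<omega> A B \<eta> n) \<theta> = (\<Sum>k<2 ^ n. (?L ^^ (2 ^ n + k)) ?D0 \<theta>)"
    by (simp only: weighted_shift_pow_sum funpow_add comp_apply)
  moreover have "D_seq \<omega> A B \<eta> (Suc n) \<theta> =
      D_seq \<omega> A B \<eta> n \<theta> + (?L ^^ 2 ^ n) (D_seq \<omega> A B \<eta> n) \<theta>"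
    by (simp only: D_seq.simps(2) weighted_shift_pow_two_power add.commute)
  ultimately have "D_seq \<omega> A B \<eta> (Suc n) \<theta> =
      (\<Sum>k<2 ^ n. (?L ^^ k) ?D0 \<theta>) + (\<Sum>k<2 ^ n. (?L ^^ (2 ^ n + k)) ?D0 \<theta>)"
    by (simp only: Suc.IH)
  also have "\<dots> = (\<Sum>k<2 ^ n + 2 ^ n. (?L ^^ k) ?D0 \<theta>)"
    using sum_split by presburger
  finally show ?case by (simp only: power_Suc mult_2)
qed

lemma superexponential_decay:
  fixes \<kappa> c M :: real
  assumes "0 \<le> \<kappa>" "\<kappa> < 1"
  shows "(\<lambda>n. exp (c * real n) * (\<kappa> ^ 2 ^ n * M)) \<longlonglongrightarrow> 0"
proof (cases "\<kappa> = 0")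
  case False
  with assms have "0 < \<kappa>" by simp
  \<comment> \<open>In the exponent, a term linear in \<open>n\<close> competes with a negative multiple of \<open>2\<^sup>n\<close>.\<close>
  define b where "b = - ln \<kappa>"
  have "0 < b"
    using \<open>0 < \<kappa>\<close> \<open>\<kappa> < 1\<close> by (simp add: b_def)
  then have "(\<lambda>n. exp (c * real n - b * 2 ^ n) * M) \<longlonglongrightarrow> 0"
    by real_asymp
  moreover have "exp (c * real n - b * 2 ^ n) * M = exp (c * real n) * (\<kappa> ^ 2 ^ n * M)" for n
  proof -
    have "\<kappa> ^ 2 ^ n = exp (2 ^ n * ln \<kappa>)"
      using \<open>0 < \<kappa>\<close> exp_of_nat_mult [of "2 ^ n" "ln \<kappa>"] by simp
    then show ?thesis
      by (simp add: b_def exp_add [symmetric])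
  qed
  ultimately show ?thesis by simp
qed (simp add: power_0_left)

section \<open>Solution of the cohomological equation\<close>

theorem mainTheorem2:
  fixes \<omega> :: "real ^ 'l::finite"
    and A :: "'l torus \<Rightarrow> real ^ 'p::finite ^ 'p"
    and B :: "'l torus \<Rightarrow> real ^ 'q::finite ^ 'q"
    and \<eta> :: "'l torus \<Rightarrow> real ^ 'q ^ 'p"
    and \<kappa> :: real
  assumes "continuous_on UNIV A"
    and "continuous_on UNIV B" and "\<And>\<theta>. invertible (B \<theta>)"
    and "continuous_on UNIV \<eta>"
    and "\<kappa> < 1"
    and "\<And>\<theta>. op_norm (A \<theta>) * op_norm (matrix_inv (B \<theta>)) \<le> \<kappa>"
  shows "\<exists>D :: 'l torus \<Rightarrow> real ^ 'q ^ 'p.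
      uniform_limit UNIV (D_seq \<omega> A B \<eta>) D sequentially \<and>
      continuous_on UNIV D \<and>
      (\<forall>c::real. c > 0 \<longrightarrow>
        (\<lambda>n. exp (c * real n) * (SUP \<theta>. op_norm (D \<theta> - D_seq \<omega> A B \<eta> n \<theta>)))
          \<longlonglongrightarrow> 0) \<and>
      (let \<Delta> = (\<lambda>\<theta>. D (\<theta> - torus_of \<omega>)) in
        \<forall>\<theta>. A \<theta> ** \<Delta> \<theta> - \<Delta> (\<theta> + torus_of \<omega>) ** B \<theta> = \<eta> \<theta>)"
proof -
  define Q where "Q = (\<lambda>\<theta>. matrix_inv (B \<theta>))"
  define L where "L = weighted_shift (torus_of \<omega>) A Q"
  define D\<^sub>0 where "D\<^sub>0 = (\<lambda>\<theta>. - (\<eta> \<theta> ** Q \<theta>))"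
  define S where "S = (\<lambda>N \<theta>. \<Sum>k<N. (L ^^ k) D\<^sub>0 \<theta>)"
  define D where "D = (\<lambda>\<theta>. \<Sum>k. (L ^^ k) D\<^sub>0 \<theta>)"

  have Q: "continuous_on UNIV Q"
    unfolding Q_def by (intro continuous_on_matrix_inv assms)
  have D0: "continuous_on UNIV D\<^sub>0"
    unfolding D\<^sub>0_def by (intro continuous_on_minus continuous_on_matrix_mult assms Q)
  have AQ: "op_norm (A \<theta>) * op_norm (Q \<theta>) \<le> \<kappa>" for \<theta>
    using assms(6) by (simp add: Q_def)
  have \<kappa>: "0 \<le> \<kappa>"
    using AQ [of 0] op_norm_nonneg by (meson mult_nonneg_nonneg order_trans)
  obtain M\<^sub>0 where M0: "\<And>\<theta>. op_norm (D\<^sub>0 \<theta>) \<le> M\<^sub>0"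
    using op_norm_bounded_on_torus [OF D0] by blast
  have D_seq: "D_seq \<omega> A B \<eta> n = S (2 ^ n)" for n
    by (simp add: fun_eq_iff D_seq_eq_partial_sum S_def L_def Q_def D\<^sub>0_def)

  define C where "C = real CARD('p) * real CARD('q)"
  have term_le: "norm ((L ^^ k) D\<^sub>0 \<theta>) \<le> C * (\<kappa> ^ k * M\<^sub>0)" for k \<theta>
  proof -
    have "norm ((L ^^ k) D\<^sub>0 \<theta>) \<le> C * op_norm ((L ^^ k) D\<^sub>0 \<theta>)"
      unfolding C_def by (rule norm_le_op_norm)
    also have "\<dots> \<le> C * (\<kappa> ^ k * M\<^sub>0)"
      unfolding L_def C_def
      by (intro mult_left_mono op_norm_weighted_shift_pow_le AQ M0) simp
    finally show ?thesis .
  qed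
  have summable_bound: "summable (\<lambda>k. C * (\<kappa> ^ k * M\<^sub>0))"
    using \<kappa> \<open>\<kappa> < 1\<close> by (intro summable_mult summable_mult2 summable_geometric) simp
  have summable: "summable (\<lambda>k. (L ^^ k) D\<^sub>0 \<theta>)" for \<theta>
    by (rule summable_comparison_test' [OF summable_bound]) (rule term_le)
  have S_lim: "uniform_limit UNIV S D sequentially"
    unfolding S_def D_def
    using term_le summable_bound by (rule Weierstrass_m_test)
  have "filterlim (\<lambda>n::nat. 2 ^ n :: nat) sequentially sequentially"
    by (rule filterlim_subseq) (simp add: strict_mono_def)
  from filterlim_compose [OF S_lim this]
  have D_lim: "uniform_limit UNIV (D_seq \<omega> A B \<eta>) D sequentially"
    by (simp add: D_seq [abs_def])
  have D_cont: "continuous_on UNIV D"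
  proof (rule uniform_limit_theorem [OF _ S_lim])
    show "\<forall>\<^sub>F N in sequentially. continuous_on UNIV (S N)"
      unfolding S_def L_def
      by (intro always_eventually allI continuous_on_sum continuous_on_weighted_shift_pow assms Q D0)
  qed simp

  have fixed: "D \<theta> = L D \<theta> + D\<^sub>0 \<theta>" for \<theta>
  proof -
    have "L D \<theta> = A \<theta> ** D (\<theta> - torus_of \<omega>) ** Q \<theta>"
      by (simp add: L_def weighted_shift_def)
    also have "\<dots> = (\<Sum>k. A \<theta> ** (L ^^ k) D\<^sub>0 (\<theta> - torus_of \<omega>) ** Q \<theta>)"
      unfolding D_def
      by (rule bounded_linear.suminf [OF bounded_linear_sandwich]) (rule summable)
    also have "\<dots> = (\<Sum>k. (L ^^ Suc k) D\<^sub>0 \<theta>)"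
      unfolding L_def weighted_shift_pow_Suc ..
    also have "\<dots> = D \<theta> - D\<^sub>0 \<theta>"
      unfolding D_def using suminf_split_head [OF summable] by simp
    finally show ?thesis by simp
  qed
  \<comment> \<open>Expressing the error through \<open>D\<close> itself, rather than as an infinite tail, lets the
    contraction estimate apply to it directly.\<close>
  have tail: "D \<theta> - S N \<theta> = (L ^^ N) D \<theta>" for N \<theta>
  proof (induction N arbitrary: \<theta>)
    case 0
    then show ?case by (simp add: S_def)
  next
    case (Suc N)
    have "(L ^^ N) D \<theta> = (L ^^ N) (\<lambda>\<theta>. L D \<theta> + D\<^sub>0 \<theta>) \<theta>"
      by (rule fun_cong [OF arg_cong [OF ext [OF fixed], where f = "L ^^ N"]])
    also have "\<dots> = (L ^^ N) (L D) \<theta> + (L ^^ N) D\<^sub>0 \<theta>"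
      unfolding L_def by (simp only: weighted_shift_pow_add)
    finally have "(L ^^ N) D \<theta> = (L ^^ Suc N) D \<theta> + (L ^^ N) D\<^sub>0 \<theta>"
      by (simp only: funpow_Suc_right comp_apply)
    moreover have "S (Suc N) \<theta> = S N \<theta> + (L ^^ N) D\<^sub>0 \<theta>"
      by (simp add: S_def)
    ultimately show ?case using Suc.IH [of \<theta>]
      by (simp add: algebra_simps del: funpow.simps)
  qed
  obtain M where M: "\<And>\<theta>. op_norm (D \<theta>) \<le> M"
    using op_norm_bounded_on_torus [OF D_cont] by blast
  have error_le: "op_norm (D \<theta> - D_seq \<omega> A B \<eta> n \<theta>) \<le> \<kappa> ^ 2 ^ n * M" for n \<theta>
    unfolding D_seq tail L_def by (rule op_norm_weighted_shift_pow_le [OF AQ M])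
  have superexp: "(\<lambda>n. exp (c * real n) * (SUP \<theta>. op_norm (D \<theta> - D_seq \<omega> A B \<eta> n \<theta>)))
      \<longlonglongrightarrow> 0" for c
  proof (rule tendsto_sandwich [OF _ _ tendsto_const superexponential_decay [OF \<kappa> \<open>\<kappa> < 1\<close>]])
    have "0 \<le> (SUP \<theta>. op_norm (D \<theta> - D_seq \<omega> A B \<eta> n \<theta>))" for n
      using error_le by (intro cSUP_upper2 [where x = 0] op_norm_nonneg bdd_aboveI2) simp_all
    then show "\<forall>\<^sub>F n in sequentially.
        0 \<le> exp (c * real n) * (SUP \<theta>. op_norm (D \<theta> - D_seq \<omega> A B \<eta> n \<theta>))"
      by simp
    have "(SUP \<theta>. op_norm (D \<theta> - D_seq \<omega> A B \<eta> n \<theta>)) \<le> \<kappa> ^ 2 ^ n * M" for n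
      by (rule cSUP_least) (simp_all add: error_le)
    then show "\<forall>\<^sub>F n in sequentially.
        exp (c * real n) * (SUP \<theta>. op_norm (D \<theta> - D_seq \<omega> A B \<eta> n \<theta>))
          \<le> exp (c * real n) * (\<kappa> ^ 2 ^ n * M)"
      by simp
  qed
  have solves: "A \<theta> ** D (\<theta> - torus_of \<omega>) - D \<theta> ** B \<theta> = \<eta> \<theta>" for \<theta>
  proof -
    have QB: "Q \<theta> ** B \<theta> = mat 1"
      by (simp add: Q_def matrix_mult_inv assms)
    have "D \<theta> ** B \<theta> = (A \<theta> ** D (\<theta> - torus_of \<omega>) ** Q \<theta> - \<eta> \<theta> ** Q \<theta>) ** B \<theta>"
      by (subst fixed) (simp add: L_def weighted_shift_def D\<^sub>0_def)
    also have "\<dots> = A \<theta> ** D (\<theta> - torus_of \<omega>) - \<eta> \<theta>"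
      by (simp add: bounded_bilinear.diff_left [OF bounded_bilinear_matrix_mult]
          QB flip: matrix_mul_assoc)
    finally show ?thesis by simp
  qed
  show ?thesis
    using D_lim D_cont superexp solves by (intro exI [of _ D]) (simp add: Let_def)
qed

end
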